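(* Let $G$ be a graph with $n$ vertices, and let $b,a,n',m,\Delta$ be non-negative integers with $b-\Delta\ge a\ge 2$, $\delta(G)\ge m+n'+\frac{b(b-\Delta)}{\Delta+a}$ and $n>\frac{(b+a+2m-1)(a+b)}{\Delta+a}+n'$. Let $g,f$ be integer-valued functions on $V(G)$ with $b-\Delta\ge f(x)-\Delta\ge g(x)\ge a$ for every vertex $x$. If for every pair of distinct non-adjacent vertices $x,y$ (i.e. $xy\notin E(G)$) we have $\max\{d_G(x),d_G(y)\}\ge\frac{(b-\Delta)n+(\Delta+a)n'}{b+a}$, then $G$ is fractional $(g,f,n',m)$-critical deleted.
   Context: All graphs are finite and simple; $\delta(G)$ is the minimum degree and $d_G(x)$ the degree of $x$. For integer-valued functions $g\le f$ on $V(G)$, a fractional $(g,f)$-factor of $G$ is a function $h:E(G)\to[0,1]$ such that $g(x)\le\sum_{e\ni x}h(e)\le f(x)$ for every vertex $x$. $G$ is fractional $(g,f,m)$-deleted if for every $H\subseteq E(G)$ with $|H|=m$, $G-H$ has a fractional $(g,f)$-factor. $G$ is fractional $(g,f,n',m)$-critical deleted if for every $U\subseteq V(G)$ with $|U|=n'$, $G-U$ is fractional $(g,f,m)$-deleted (with $g,f$ restricted to $V(G)\setminus U$). *)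

theory Defs
  imports Complex_Main
begin

definition simple_graph :: "'a set \<Rightarrow> 'a set set \<Rightarrow> bool" where
  "simple_graph V E \<longleftrightarrow> finite V \<and> (\<forall>e\<in>E. e \<subseteq> V \<and> card e = 2)"

definition incident_edges :: "'a set set \<Rightarrow> 'a \<Rightarrow> 'a set set" where
  "incident_edges E x = {e \<in> E. x \<in> e}"

definition vertex_degree :: "'a set set \<Rightarrow> 'a \<Rightarrow> nat" where
  "vertex_degree E x = card (incident_edges E x)"

text \<open>Only meaningful for a nonempty finite vertex set.\<close>
definition min_degree :: "'a set \<Rightarrow> 'a set set \<Rightarrow> nat" where
  "min_degree V E = Min (vertex_degree E ` V)"

text \<open>The edge set of \<open>G - U\<close>; its vertex set is \<open>V - U\<close>.\<close>
definition edges_minus :: "'a set set \<Rightarrow> 'a set \<Rightarrow> 'a set set" where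
  "edges_minus E U = {e \<in> E. e \<inter> U = {}}"

text \<open>The values of \<open>g\<close> and \<open>f\<close> outside \<open>V\<close>, and of \<open>h\<close> outside \<open>E\<close>, are irrelevant;
  so restricting \<open>g\<close> and \<open>f\<close> to a smaller vertex set needs no notation.\<close>
definition fractional_factor ::
  "'a set \<Rightarrow> 'a set set \<Rightarrow> ('a \<Rightarrow> int) \<Rightarrow> ('a \<Rightarrow> int) \<Rightarrow> ('a set \<Rightarrow> real) \<Rightarrow> bool" where
  "fractional_factor V E g f h \<longleftrightarrow>
     (\<forall>e\<in>E. 0 \<le> h e \<and> h e \<le> 1) \<and>
     (\<forall>x\<in>V. of_int (g x) \<le> (\<Sum>e\<in>incident_edges E x. h e) \<and>
            (\<Sum>e\<in>incident_edges E x. h e) \<le> of_int (f x))"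

definition fractional_deleted ::
  "'a set \<Rightarrow> 'a set set \<Rightarrow> ('a \<Rightarrow> int) \<Rightarrow> ('a \<Rightarrow> int) \<Rightarrow> nat \<Rightarrow> bool" where
  "fractional_deleted V E g f m \<longleftrightarrow>
     (\<forall>H. H \<subseteq> E \<and> card H = m \<longrightarrow> (\<exists>h. fractional_factor V (E - H) g f h))"

definition fractional_critical_deleted ::
  "'a set \<Rightarrow> 'a set set \<Rightarrow> ('a \<Rightarrow> int) \<Rightarrow> ('a \<Rightarrow> int) \<Rightarrow> nat \<Rightarrow> nat \<Rightarrow> bool" where
  "fractional_critical_deleted V E g f n' m \<longleftrightarrow>
     (\<forall>U. U \<subseteq> V \<and> card U = n' \<longrightarrow> fractional_deleted (V - U) (edges_minus E U) g f m)"

end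

theory Submission
  imports Defs "HOL-Analysis.Function_Topology"
begin

text \<open>A fractional \<open>(g, f)\<close>-factor exists if \<open>g(T) \<le> f(S) + \<Sum>\<^bsub>x \<in> T\<^esub> d\<^bsub>G - S\<^esub>(x)\<close> for all disjoint
  \<open>S\<close> and \<open>T\<close> with \<open>d\<^bsub>G - S\<^esub> < g\<close> on \<open>T\<close> (Anstee). Choose edge weights in \<open>[0, 1]\<close> such that the
  signed distances \<open>z x\<close> from the weighted degrees to the intervals \<open>[g x, f x]\<close> have least square sum.
  Then edges \<open>xy\<close> with \<open>z x + z y > 0\<close> have weight 1 and those with \<open>z x + z y < 0\<close> weight 0. If \<open>z\<close> does not
  vanish, the sets \<open>T\<close> and \<open>S\<close> where \<open>z\<close> attains \<open>max |z|\<close> and \<open>- max |z|\<close> violate the cut condition.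

  Put \<open>A = a + \<Delta>\<close>, \<open>B = b - \<Delta>\<close> and \<open>N = n - n'\<close>. Given \<open>U\<close>, \<open>H\<close>, \<open>S\<close> and \<open>T\<close>, let \<open>d x\<close> be the degree
  of \<open>x\<close> in \<open>G - U - H - S\<close> and \<open>h x\<close> its degree in \<open>H\<close>. It suffices that
  \<open>B |T| \<le> A |S| + \<Sum>\<^bsub>x \<in> T\<^esub> d x\<close>, where \<open>d < B\<close> on \<open>T\<close>. If \<open>|T| \<le> b\<close>, or if \<open>d + h \<ge> B\<close> on \<open>T\<close>, this
  is the minimum degree condition at a vertex minimising \<open>d\<close>, respectively \<open>d + h\<close>. Otherwise let \<open>L\<close>
  be the set of those vertices of \<open>T\<close> whose degree lies below the bound of the degree hypothesis. It
  is a clique of \<open>G\<close>, hence \<open>d + h \<ge> |L| - 1\<close> on \<open>L\<close>, while \<open>\<rho> = min\<^bsub>T - L\<^esub> (d + h)\<close> satisfies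
  \<open>B N \<le> (A + B) (|S| + \<rho>)\<close>. As \<open>\<Sum> h \<le> 2m\<close>, the claim reduces to integer inequalities in \<open>\<rho>\<close>,
  \<open>|L|\<close> and \<open>|T - L|\<close>, which follow from the lower bound on \<open>n\<close>.\<close>

section \<open>Degrees\<close>

lemma finite_edges:
  assumes "simple_graph V E"
  shows "finite E"
proof (rule finite_subset)
  show "E \<subseteq> Pow V" "finite (Pow V)" using assms by (auto simp: simple_graph_def)
qed

lemma edge_cases:
  assumes "simple_graph V E" "e \<in> E"
  obtains x y where "e = {x, y}" "x \<noteq> y" "x \<in> V" "y \<in> V"
proof -
  have "card e = 2" "e \<subseteq> V" using assms by (auto simp: simple_graph_def)
  then show thesis using that by (auto simp: card_2_iff)
qed

lemma simple_graph_edges_minus: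
  assumes "simple_graph V E"
  shows "simple_graph (V - U) (edges_minus E U - H)"
  using assms by (fastforce simp: simple_graph_def edges_minus_def)

lemma edges_minus_edges_minus_Diff:
  "edges_minus (edges_minus E U - H) S = edges_minus E (U \<union> S) - H"
  by (auto simp: edges_minus_def)

lemma finite_incident_edges: "finite E \<Longrightarrow> finite (incident_edges E x)"
  by (simp add: incident_edges_def)

lemma sum_incident_edges:
  fixes w :: "'a set \<Rightarrow> 'b::semiring_1"
  assumes "finite T" "finite E"
  shows "(\<Sum>x\<in>T. \<Sum>e\<in>incident_edges E x. w e) = (\<Sum>e\<in>E. of_nat (card (e \<inter> T)) * w e)"
proof -
  have "(\<Sum>x\<in>T. \<Sum>e\<in>incident_edges E x. w e) = (\<Sum>x\<in>T. \<Sum>e | e \<in> E \<and> x \<in> e. w e)"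
    by (simp add: incident_edges_def)
  also have "\<dots> = (\<Sum>e\<in>E. \<Sum>x | x \<in> T \<and> x \<in> e. w e)" by (rule sum.swap_restrict[OF assms])
  also have "\<dots> = (\<Sum>e\<in>E. of_nat (card (e \<inter> T)) * w e)"
    by (simp add: Int_def conj_commute)
  finally show ?thesis .
qed

lemma sum_vertex_degree:
  assumes "finite T" "finite E"
  shows "(\<Sum>x\<in>T. vertex_degree E x) = (\<Sum>e\<in>E. card (e \<inter> T))"
  using sum_incident_edges[OF assms, of "\<lambda>_. 1 :: nat"] by (simp add: vertex_degree_def)

lemma sum_vertex_degree_le:
  assumes "finite T" "simple_graph V H"
  shows "(\<Sum>x\<in>T. vertex_degree H x) \<le> 2 * card H"
proof -
  have "card (e \<inter> T) \<le> 2" if "e \<in> H" for e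
  proof -
    have "card e = 2" using assms(2) that by (simp add: simple_graph_def)
    then show ?thesis using card_mono[of e "e \<inter> T"] card.infinite[of e] by fastforce
  qed
  then have "(\<Sum>e\<in>H. card (e \<inter> T)) \<le> (\<Sum>e\<in>H. 2)" by (rule sum_mono)
  then show ?thesis using sum_vertex_degree[OF assms(1) finite_edges[OF assms(2)]] by simp
qed

lemma min_degree_le_vertex_degree:
  assumes "simple_graph V E" "x \<in> V"
  shows "min_degree V E \<le> vertex_degree E x"
  using assms unfolding min_degree_def by (intro Min_le) (auto simp: simple_graph_def)

lemma vertex_degree_le_card: "finite E \<Longrightarrow> vertex_degree E x \<le> card E"
  by (auto simp: vertex_degree_def incident_edges_def intro: card_mono)

lemma card_le_vertex_degree:
  assumes "finite E" "\<And>y. y \<in> Y \<Longrightarrow> {x, y} \<in> E"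
  shows "card Y \<le> vertex_degree E x"
  unfolding vertex_degree_def
proof (rule card_inj_on_le)
  show "inj_on (\<lambda>y. {x, y}) Y" by (auto simp: inj_on_def doubleton_eq_iff)
  show "(\<lambda>y. {x, y}) ` Y \<subseteq> incident_edges E x" using assms(2) by (auto simp: incident_edges_def)
qed (simp add: assms(1) finite_incident_edges)

lemma vertex_degree_le_Diff:
  assumes "finite E" "finite H"
  shows "vertex_degree E x \<le> vertex_degree H x + vertex_degree (E - H) x"
proof -
  have "card (incident_edges E x) \<le> card (incident_edges H x \<union> incident_edges (E - H) x)"
    using assms by (intro card_mono) (auto simp: incident_edges_def)
  also have "\<dots> \<le> card (incident_edges H x) + card (incident_edges (E - H) x)" by (rule card_Un_le)
  finally show ?thesis by (simp add: vertex_degree_def)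
qed

lemma vertex_degree_le_edges_minus:
  assumes "simple_graph V E" "finite U" "x \<notin> U"
  shows "vertex_degree E x \<le> card U + vertex_degree (edges_minus E U) x"
proof -
  have "incident_edges E x \<subseteq> (\<lambda>u. {x, u}) ` U \<union> incident_edges (edges_minus E U) x"
  proof
    fix e assume "e \<in> incident_edges E x"
    then have "e \<in> E" "x \<in> e" by (auto simp: incident_edges_def)
    then obtain y where "e = {x, y}" using assms(1) by (elim edge_cases) auto
    then show "e \<in> (\<lambda>u. {x, u}) ` U \<union> incident_edges (edges_minus E U) x"
      using \<open>e \<in> E\<close> assms(3) by (auto simp: incident_edges_def edges_minus_def)
  qed
  then have "vertex_degree E x
      \<le> card ((\<lambda>u. {x, u}) ` U \<union> incident_edges (edges_minus E U) x)"
    using finite_edges[OF assms(1)] assms(2)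
    by (auto simp: vertex_degree_def incident_edges_def edges_minus_def intro!: card_mono)
  also have "\<dots> \<le> card ((\<lambda>u. {x, u}) ` U) + vertex_degree (edges_minus E U) x"
    unfolding vertex_degree_def by (rule card_Un_le)
  also have "card ((\<lambda>u. {x, u}) ` U) \<le> card U" using assms(2) by (rule card_image_le)
  finally show ?thesis by simp
qed

section \<open>Weightings of least total squared defect\<close>

abbreviation weighted_degree :: "'a set set \<Rightarrow> ('a set \<Rightarrow> real) \<Rightarrow> 'a \<Rightarrow> real" where
  "weighted_degree E h x \<equiv> \<Sum>e\<in>incident_edges E x. h e"

lemma weighted_degree_fun_upd:
  assumes "finite E" "e \<in> E"
  shows "weighted_degree E (h(e := h e + \<epsilon>)) x = weighted_degree E h x + of_bool (x \<in> e) * \<epsilon>"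
proof -
  have "weighted_degree E (h(e := h e + \<epsilon>)) x
      = weighted_degree E h x + (\<Sum>e'\<in>incident_edges E x. if e' = e then \<epsilon> else 0)"
    unfolding sum.distrib[symmetric] by (rule sum.cong) auto
  then show ?thesis using assms by (simp add: finite_incident_edges) (simp add: incident_edges_def)
qed

definition interval_defect :: "real \<Rightarrow> real \<Rightarrow> real \<Rightarrow> real" where
  "interval_defect l u x = max l (min x u) - x"

lemma interval_defect_eq_lower: "0 < interval_defect l u x \<Longrightarrow> interval_defect l u x = l - x"
  by (auto simp: interval_defect_def max_def min_def split: if_splits)

lemma interval_defect_eq_upper: "l \<le> u \<Longrightarrow> interval_defect l u x < 0 \<Longrightarrow> interval_defect l u x = u - x"
  by (auto simp: interval_defect_def max_def min_def split: if_splits)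

lemma interval_defect_eq_0_iff: "l \<le> u \<Longrightarrow> interval_defect l u x = 0 \<longleftrightarrow> l \<le> x \<and> x \<le> u"
  by (auto simp: interval_defect_def max_def min_def)

lemma interval_defect_add_square_le:
  assumes "l \<le> u"
  shows "(interval_defect l u (x + \<epsilon>))\<^sup>2 \<le> (interval_defect l u x - \<epsilon>)\<^sup>2"
proof -
  have "\<bar>interval_defect l u (x + \<epsilon>)\<bar> \<le> \<bar>interval_defect l u x - \<epsilon>\<bar>"
    using assms by (auto simp: interval_defect_def max_def min_def)
  then show ?thesis by (simp add: abs_le_square_iff)
qed

definition vertex_defect ::
  "'a set set \<Rightarrow> ('a \<Rightarrow> real) \<Rightarrow> ('a \<Rightarrow> real) \<Rightarrow> ('a set \<Rightarrow> real) \<Rightarrow> 'a \<Rightarrow> real" where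
  "vertex_defect E g f h x = interval_defect (g x) (f x) (weighted_degree E h x)"

lemma vertex_defect_fun_upd_square_le:
  assumes "finite E" "e \<in> E" "g x \<le> f x"
  shows "(vertex_defect E g f (h(e := h e + \<epsilon>)) x)\<^sup>2
    \<le> (vertex_defect E g f h x)\<^sup>2 + (\<epsilon>\<^sup>2 - 2 * \<epsilon> * vertex_defect E g f h x) * of_bool (x \<in> e)"
  using interval_defect_add_square_le[OF assms(3), of "weighted_degree E h x" \<epsilon>]
  unfolding vertex_defect_def weighted_degree_fun_upd[OF assms(1,2)]
  by (auto simp: power2_diff algebra_simps)

lemma ex_least_square_defect:
  obtains h where "range h \<subseteq> {0..1}"
    and "\<And>h'. range h' \<subseteq> {0..1} \<Longrightarrow>
      (\<Sum>x\<in>V. (vertex_defect E g f h x)\<^sup>2) \<le> (\<Sum>x\<in>V. (vertex_defect E g f h' x)\<^sup>2)"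
proof -
  define K :: "('a set \<Rightarrow> real) set" where "K = (\<Pi>\<^sub>E e\<in>UNIV. {0..1})"
  have "compact K"
    using compactin_PiE[of "\<lambda>_. euclidean" UNIV "\<lambda>_. {0..1::real}"]
    by (simp add: K_def euclidean_product_topology)
  moreover have "K \<noteq> {}" by (simp add: K_def PiE_eq_empty_iff)
  moreover have "continuous_on K (\<lambda>h. \<Sum>x\<in>V. (vertex_defect E g f h x)\<^sup>2)"
    unfolding vertex_defect_def interval_defect_def
    by (intro continuous_intros continuous_on_subset[OF continuous_on_product_coordinates]) auto
  ultimately obtain h where "h \<in> K" "\<And>h'. h' \<in> K \<Longrightarrow>
      (\<Sum>x\<in>V. (vertex_defect E g f h x)\<^sup>2) \<le> (\<Sum>x\<in>V. (vertex_defect E g f h' x)\<^sup>2)"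
    using continuous_attains_inf[of K "\<lambda>h. \<Sum>x\<in>V. (vertex_defect E g f h x)\<^sup>2"] by blast
  then show thesis by (intro that) (auto simp: K_def image_subset_iff PiE_iff)
qed

lemma sum_vertex_defect_edge_le:
  assumes G: "simple_graph V E" and gf: "\<And>x. x \<in> V \<Longrightarrow> g x \<le> f x" and "e \<in> E"
    and no_decrease: "(\<Sum>x\<in>V. (vertex_defect E g f h x)\<^sup>2)
      \<le> (\<Sum>x\<in>V. (vertex_defect E g f (h(e := h e + \<epsilon>)) x)\<^sup>2)"
  shows "\<epsilon> * (\<Sum>x\<in>e. vertex_defect E g f h x) \<le> \<epsilon>\<^sup>2"
proof -
  let ?z = "vertex_defect E g f h"
  have e: "V \<inter> e = e" "finite V" "card e = 2"
    using G \<open>e \<in> E\<close> by (auto simp: simple_graph_def)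
  note no_decrease
  also have "(\<Sum>x\<in>V. (vertex_defect E g f (h(e := h e + \<epsilon>)) x)\<^sup>2)
      \<le> (\<Sum>x\<in>V. (?z x)\<^sup>2 + (\<epsilon>\<^sup>2 - 2 * \<epsilon> * ?z x) * of_bool (x \<in> e))"
    using finite_edges[OF G] \<open>e \<in> E\<close> gf
    by (intro sum_mono vertex_defect_fun_upd_square_le) auto
  also have "\<dots> = (\<Sum>x\<in>V. (?z x)\<^sup>2) + (\<Sum>x\<in>e. \<epsilon>\<^sup>2 - 2 * \<epsilon> * ?z x)"
    using e by (simp add: sum.distrib)
  finally show ?thesis using e(3) by (simp add: sum_subtractf flip: sum_distrib_left)
qed

lemma ex_complementary_weighting:
  assumes G: "simple_graph V E" and gf: "\<And>x. x \<in> V \<Longrightarrow> g x \<le> f x"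
  obtains h where "range h \<subseteq> {0..1}"
    and "\<And>e. e \<in> E \<Longrightarrow> 0 < (\<Sum>x\<in>e. vertex_defect E g f h x) \<Longrightarrow> h e = 1"
    and "\<And>e. e \<in> E \<Longrightarrow> (\<Sum>x\<in>e. vertex_defect E g f h x) < 0 \<Longrightarrow> h e = 0"
proof -
  obtain h where h: "range h \<subseteq> {0..1}" and least: "\<And>h'. range h' \<subseteq> {0..1} \<Longrightarrow>
      (\<Sum>x\<in>V. (vertex_defect E g f h x)\<^sup>2) \<le> (\<Sum>x\<in>V. (vertex_defect E g f h' x)\<^sup>2)"
    using ex_least_square_defect[where V = V and E = E and g = g and f = f] by blast
  let ?z = "vertex_defect E g f h"
  have step: "\<epsilon> * sum ?z e \<le> \<epsilon>\<^sup>2" if "e \<in> E" "0 \<le> h e + \<epsilon>" "h e + \<epsilon> \<le> 1" for e \<epsilon>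
  proof (rule sum_vertex_defect_edge_le[OF G gf \<open>e \<in> E\<close> least])
    show "range (h(e := h e + \<epsilon>)) \<subseteq> {0..1}" using h that(2,3) by (auto simp: image_subset_iff)
  qed
  show thesis
  proof (rule that[OF h])
    fix e assume e: "e \<in> E"
    have h01: "0 \<le> h e" "h e \<le> 1" using h by (auto simp: image_subset_iff)
    show "h e = 1" if pos: "0 < sum ?z e"
    proof (rule ccontr)
      assume "h e \<noteq> 1"
      define \<epsilon> where "\<epsilon> = min (1 - h e) (sum ?z e / 2)"
      have "0 < \<epsilon>" "h e + \<epsilon> \<le> 1" "\<epsilon> < sum ?z e" using \<open>h e \<noteq> 1\<close> h01 pos by (auto simp: \<epsilon>_def)
      then show False using step[OF e, of \<epsilon>] h01 by (simp add: power2_eq_square)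
    qed
    show "h e = 0" if neg: "sum ?z e < 0"
    proof (rule ccontr)
      assume "h e \<noteq> 0"
      define \<epsilon> where "\<epsilon> = max (- h e) (sum ?z e / 2)"
      have "\<epsilon> < 0" "0 \<le> h e + \<epsilon>" "sum ?z e < \<epsilon>" using \<open>h e \<noteq> 0\<close> h01 neg by (auto simp: \<epsilon>_def)
      then show False using step[OF e, of \<epsilon>] h01 by (simp add: power2_eq_square)
    qed
  qed
qed

lemma sum_vertex_degree_edges_minus:
  assumes G: "simple_graph V E" and fin: "finite S" "finite T" and disj: "S \<inter> T = {}"
    and full: "\<And>x y. {x, y} \<in> E \<Longrightarrow> x \<in> T \<Longrightarrow> y \<notin> S \<Longrightarrow> h {x, y} = 1"
    and empty: "\<And>x y. {x, y} \<in> E \<Longrightarrow> x \<in> S \<Longrightarrow> y \<notin> T \<Longrightarrow> h {x, y} = 0"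
  shows "(\<Sum>x\<in>T. real (vertex_degree (edges_minus E S) x))
    = (\<Sum>x\<in>T. weighted_degree E h x) - (\<Sum>x\<in>S. weighted_degree E h x)"
proof -
  have finE: "finite E" using G by (rule finite_edges)
  have edge_balance: "of_bool (e \<inter> S = {}) * real (card (e \<inter> T))
      = real (card (e \<inter> T)) * h e - real (card (e \<inter> S)) * h e" if "e \<in> E" for e
  proof -
    obtain x y where e: "e = {x, y}" "x \<noteq> y" using G \<open>e \<in> E\<close> by (rule edge_cases)
    then have "e = {y, x}" by auto
    then show ?thesis
      using e that disj full[of x y] full[of y x] empty[of x y] empty[of y x]
      by (auto simp: Int_insert_left)
  qed
  have "(\<Sum>x\<in>T. real (vertex_degree (edges_minus E S) x)) = (\<Sum>e\<in>edges_minus E S. real (card (e \<inter> T)))"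
    using sum_vertex_degree[OF fin(2), of "edges_minus E S"] finE
    by (simp add: edges_minus_def flip: of_nat_sum)
  also have "\<dots> = (\<Sum>e\<in>E. of_bool (e \<inter> S = {}) * real (card (e \<inter> T)))"
    using finE by (simp add: edges_minus_def Int_def)
  also have "\<dots> = (\<Sum>x\<in>T. weighted_degree E h x) - (\<Sum>x\<in>S. weighted_degree E h x)"
    using edge_balance fin finE by (simp add: sum_incident_edges flip: sum_subtractf)
  finally show ?thesis .
qed

lemma vertex_degree_edges_minus_le_weighted_degree:
  assumes G: "simple_graph V E" and h: "range h \<subseteq> {0..1}"
    and full: "\<And>y. {x, y} \<in> E \<Longrightarrow> y \<notin> S \<Longrightarrow> h {x, y} = 1"
  shows "real (vertex_degree (edges_minus E S) x) \<le> weighted_degree E h x"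
proof -
  have sub: "incident_edges (edges_minus E S) x \<subseteq> incident_edges E x"
    by (auto simp: incident_edges_def edges_minus_def)
  have "h e = 1" if "e \<in> incident_edges (edges_minus E S) x" for e
  proof -
    have e: "e \<in> E" "x \<in> e" "e \<inter> S = {}" using that by (auto simp: incident_edges_def edges_minus_def)
    then obtain y where "e = {x, y}" using G by (elim edge_cases) auto
    then show ?thesis using e full by auto
  qed
  then have "real (vertex_degree (edges_minus E S) x)
      = (\<Sum>e\<in>incident_edges (edges_minus E S) x. h e)"
    by (simp add: vertex_degree_def)
  also have "\<dots> \<le> weighted_degree E h x"
    using sub h finite_edges[OF G] by (intro sum_mono2) (auto simp: finite_incident_edges image_subset_iff)
  finally show ?thesis .
qed

section \<open>The cut condition for fractional factors\<close>

lemma fractional_factor_if_vertex_defect_0: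
  assumes "range h \<subseteq> {0..1}" and "\<And>x. x \<in> V \<Longrightarrow> g x \<le> f x"
    and "\<And>x. x \<in> V \<Longrightarrow> vertex_defect E g f h x = 0"
  shows "fractional_factor V E g f h"
proof -
  have "of_int (g x) \<le> weighted_degree E h x \<and> weighted_degree E h x \<le> of_int (f x)"
    if "x \<in> V" for x
    using assms(2,3)[OF that] by (simp add: vertex_defect_def interval_defect_eq_0_iff)
  then show ?thesis using assms(1) by (auto simp: fractional_factor_def image_subset_iff)
qed

lemma ex_extremal_cut:
  fixes z :: "'a \<Rightarrow> real"
  assumes G: "simple_graph V E" and v: "v \<in> V" "z v \<noteq> 0"
    and full: "\<And>e. e \<in> E \<Longrightarrow> 0 < (\<Sum>x\<in>e. z x) \<Longrightarrow> h e = 1"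
    and empty: "\<And>e. e \<in> E \<Longrightarrow> (\<Sum>x\<in>e. z x) < 0 \<Longrightarrow> h e = 0"
  obtains S T M where "S \<subseteq> V" "T \<subseteq> V" "S \<inter> T = {}" "S \<union> T \<noteq> {}" "0 < M"
    and "\<forall>x\<in>S. z x = - M" "\<forall>x\<in>T. z x = M"
    and "\<forall>x\<in>T. \<forall>y. {x, y} \<in> E \<longrightarrow> y \<notin> S \<longrightarrow> h {x, y} = 1"
    and "\<forall>x\<in>S. \<forall>y. {x, y} \<in> E \<longrightarrow> y \<notin> T \<longrightarrow> h {x, y} = 0"
proof -
  define M where "M = Max ((\<lambda>x. \<bar>z x\<bar>) ` V)"
  define S where "S = {x \<in> V. z x = - M}"
  define T where "T = {x \<in> V. z x = M}"
  have finV: "finite V" using G by (simp add: simple_graph_def)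
  have z_le: "\<bar>z x\<bar> \<le> M" if "x \<in> V" for x using finV that by (simp add: M_def)
  have "0 < M" using v z_le[of v] by simp
  have edge: "x \<in> V" "y \<in> V" "(\<Sum>w\<in>{x, y}. z w) = z x + z y" if "{x, y} \<in> E" for x y
  proof -
    have "{x, y} \<subseteq> V" "card {x, y} = 2" using G that unfolding simple_graph_def by blast+
    then show "x \<in> V" "y \<in> V" "(\<Sum>w\<in>{x, y}. z w) = z x + z y" by (cases "x = y"; simp)+
  qed
  have "M \<in> (\<lambda>x. \<bar>z x\<bar>) ` V" unfolding M_def using finV v(1) by (intro Max_in) auto
  then obtain w where "w \<in> V" "M = \<bar>z w\<bar>" by blast
  then have "w \<in> S \<union> T" by (simp add: S_def T_def abs_if)
  then have "S \<union> T \<noteq> {}" by blast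
  have "S \<inter> T = {}" using \<open>0 < M\<close> by (auto simp: S_def T_def)
  have "h {x, y} = 1" if "{x, y} \<in> E" "x \<in> T" "y \<notin> S" for x y
  proof (rule full[OF that(1)])
    have "z y \<noteq> - M" "z x = M" using edge[OF that(1)] that(2,3) by (simp_all add: S_def T_def)
    then show "0 < (\<Sum>w\<in>{x, y}. z w)" using edge[OF that(1)] z_le[of y] by linarith
  qed
  moreover have "h {x, y} = 0" if "{x, y} \<in> E" "x \<in> S" "y \<notin> T" for x y
  proof (rule empty[OF that(1)])
    have "z y \<noteq> M" "z x = - M" using edge[OF that(1)] that(2,3) by (simp_all add: S_def T_def)
    then show "(\<Sum>w\<in>{x, y}. z w) < 0" using edge[OF that(1)] z_le[of y] by linarith
  qed
  moreover have "S \<subseteq> V" "T \<subseteq> V" "\<forall>x\<in>S. z x = - M" "\<forall>x\<in>T. z x = M"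
    by (auto simp: S_def T_def)
  ultimately show thesis
    using that[of S T M] \<open>S \<inter> T = {}\<close> \<open>S \<union> T \<noteq> {}\<close> \<open>0 < M\<close> by blast
qed

theorem fractional_factor_if_cut_condition:
  assumes G: "simple_graph V E"
    and gf: "\<And>x. x \<in> V \<Longrightarrow> g x \<le> f x"
    and cut: "\<And>S T. S \<subseteq> V \<Longrightarrow> T \<subseteq> V \<Longrightarrow> S \<inter> T = {} \<Longrightarrow>
      (\<And>x. x \<in> T \<Longrightarrow> int (vertex_degree (edges_minus E S) x) < g x) \<Longrightarrow>
      (\<Sum>x\<in>T. g x) \<le> (\<Sum>x\<in>S. f x) + (\<Sum>x\<in>T. int (vertex_degree (edges_minus E S) x))"
  shows "\<exists>h. fractional_factor V E g f h"
proof (rule ccontr)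
  assume no_factor: "\<nexists>h. fractional_factor V E g f h"
  obtain h where h: "range h \<subseteq> {0..1}"
    and compl: "\<And>e. e \<in> E \<Longrightarrow> 0 < (\<Sum>x\<in>e. vertex_defect E g f h x) \<Longrightarrow> h e = 1"
      "\<And>e. e \<in> E \<Longrightarrow> (\<Sum>x\<in>e. vertex_defect E g f h x) < 0 \<Longrightarrow> h e = 0"
    using ex_complementary_weighting[OF G, of g f] gf by auto
  obtain v where v: "v \<in> V" "vertex_defect E g f h v \<noteq> 0"
    using no_factor fractional_factor_if_vertex_defect_0[of h V g f E] h gf by blast
  obtain S T M where ST: "S \<subseteq> V" "T \<subseteq> V" "S \<inter> T = {}" "S \<union> T \<noteq> {}" and "0 < M"
    and extremal: "\<forall>x\<in>S. vertex_defect E g f h x = - M" "\<forall>x\<in>T. vertex_defect E g f h x = M"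
    and full: "\<forall>x\<in>T. \<forall>y. {x, y} \<in> E \<longrightarrow> y \<notin> S \<longrightarrow> h {x, y} = 1"
    and empty: "\<forall>x\<in>S. \<forall>y. {x, y} \<in> E \<longrightarrow> y \<notin> T \<longrightarrow> h {x, y} = 0"
    by (rule ex_extremal_cut[where z = "vertex_defect E g f h" and h = h, OF G v compl])
  have fin: "finite S" "finite T" using G ST(1,2) unfolding simple_graph_def by (metis finite_subset)+
  have deg_T: "weighted_degree E h x = of_int (g x) - M" if "x \<in> T" for x
    using bspec[OF extremal(2) that] \<open>0 < M\<close> interval_defect_eq_lower[of "g x" "f x" "weighted_degree E h x"]
    by (simp add: vertex_defect_def)
  have deg_S: "weighted_degree E h x = of_int (f x) + M" if "x \<in> S" for x
    using bspec[OF extremal(1) that] \<open>0 < M\<close> gf[of x] ST(1) that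
      interval_defect_eq_upper[of "g x" "f x" "weighted_degree E h x"]
    by (auto simp: vertex_defect_def)
  have small: "int (vertex_degree (edges_minus E S) x) < g x" if "x \<in> T" for x
  proof -
    have "real (vertex_degree (edges_minus E S) x) \<le> weighted_degree E h x"
      using G h by (rule vertex_degree_edges_minus_le_weighted_degree) (use full that in blast)
    then show ?thesis using deg_T[OF that] \<open>0 < M\<close> by linarith
  qed
  have "real_of_int (\<Sum>x\<in>T. g x)
      \<le> of_int ((\<Sum>x\<in>S. f x) + (\<Sum>x\<in>T. int (vertex_degree (edges_minus E S) x)))"
    unfolding of_int_le_iff using ST(1-3) small by (rule cut)
  moreover have "(\<Sum>x\<in>T. real (vertex_degree (edges_minus E S) x))
      = (\<Sum>x\<in>T. weighted_degree E h x) - (\<Sum>x\<in>S. weighted_degree E h x)"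
    using G fin ST(3) by (rule sum_vertex_degree_edges_minus) (use full empty in blast)+
  ultimately have "M * real (card S + card T) \<le> 0"
    by (simp add: deg_T deg_S sum_subtractf sum.distrib algebra_simps)
  moreover have "0 < card S + card T" using ST(4) fin by (auto simp: card_gt_0_iff)
  ultimately show False using \<open>0 < M\<close> by (simp add: mult_le_0_iff)
qed

section \<open>Integer inequalities behind the cut condition\<close>

lemma cut_inequality_few_vertices:
  fixes d :: "'a \<Rightarrow> int" and A B b s :: int
  assumes "finite T" "int (card T) \<le> b" "A \<le> b" "0 \<le> A * s"
    and d: "\<And>x. x \<in> T \<Longrightarrow> 0 \<le> d x" "\<And>x. x \<in> T \<Longrightarrow> d x \<le> B"
    and lower: "\<And>x. x \<in> T \<Longrightarrow> b * B \<le> A * (s + d x)"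
  shows "int (card T) * B \<le> A * s + (\<Sum>x\<in>T. d x)"
proof (cases "T = {}")
  case True
  then show ?thesis using assms(4) by simp
next
  case False
  define t where "t = int (card T)"
  obtain x where x: "x \<in> T" "\<And>y. y \<in> T \<Longrightarrow> d x \<le> d y"
    using ex_min_if_finite[of "d ` T"] \<open>finite T\<close> False by (auto simp: not_less)
  have "(A - t) * d x \<le> (b - t) * B"
  proof (cases "t \<le> A")
    case True
    then show ?thesis using d[OF x(1)] assms(3) by (intro mult_mono) auto
  next
    case False
    then have "(A - t) * d x \<le> 0" using d(1)[OF x(1)] by (intro mult_nonpos_nonneg) auto
    also have "0 \<le> (b - t) * B" using assms(2) d[OF x(1)] by (simp add: t_def)
    finally show ?thesis .
  qed
  moreover have "t * d x \<le> (\<Sum>y\<in>T. d y)" unfolding t_def using x(2) by (rule sum_bounded_below)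
  ultimately show ?thesis using lower[OF x(1)] by (simp add: t_def algebra_simps)
qed

lemma cut_inequality_small_deficits:
  fixes d h :: "'a \<Rightarrow> int" and A B b m s :: int
  assumes "2 \<le> card T" "2 \<le> A" "A \<le> b" "0 \<le> B" "0 \<le> s"
    and deficit: "\<And>x. x \<in> T \<Longrightarrow> B \<le> h x + d x" and h: "(\<Sum>x\<in>T. h x) \<le> 2 * m"
    and lower: "\<And>x. x \<in> T \<Longrightarrow> A * m + b * B \<le> A * (s + h x + d x)"
  shows "int (card T) * B \<le> A * s + (\<Sum>x\<in>T. d x)"
proof -
  define e where "e x = h x + d x - B" for x
  have "finite T" "T \<noteq> {}" using assms(1) card.infinite by force+
  then obtain x where x: "x \<in> T" "\<And>y. y \<in> T \<Longrightarrow> e x \<le> e y"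
    using ex_min_if_finite[of "e ` T"] by (auto simp: not_less)
  have "A * B \<le> b * B" using assms by (intro mult_right_mono)
  then have "A * m \<le> A * (s + e x)" using lower[OF x(1)] by (simp add: e_def algebra_simps)
  then have "m \<le> s + e x" using assms(2) by simp
  moreover have "2 * e x \<le> int (card T) * e x"
    using assms(1) deficit[OF x(1)] by (intro mult_right_mono) (auto simp: e_def)
  moreover have "int (card T) * e x \<le> (\<Sum>y\<in>T. e y)" using x(2) by (rule sum_bounded_below)
  moreover have "(\<Sum>y\<in>T. e y) = (\<Sum>y\<in>T. h y) + (\<Sum>y\<in>T. d y) - int (card T) * B"
    by (simp add: e_def sum.distrib sum_subtractf)
  moreover have "2 * s \<le> A * s" using assms by (intro mult_right_mono)
  ultimately show ?thesis using h by linarith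
qed

lemma quadratic_form_ge_minus_1:
  fixes x y :: int
  shows "- 1 \<le> x * x - x * y + y * y - x - y"
proof -
  have "2 * (x * x - x * y + y * y - x - y) + 2 = (x - y)\<^sup>2 + (x - 1)\<^sup>2 + (y - 1)\<^sup>2"
    by (simp add: power2_eq_square algebra_simps)
  also have "0 \<le> \<dots>" by simp
  finally show ?thesis by simp
qed

lemma cut_inequality_low_threshold:
  fixes A B N m s k l \<rho> :: int
  assumes "2 \<le> A" "2 \<le> B" "0 \<le> m" "1 \<le> \<rho>" "\<rho> \<le> B"
    and kl: "s + k + l \<le> N"
    and big: "(A + B + 2 * m - 1) * (A + B) < A * N"
    and \<rho>: "B * N \<le> (A + B) * (s + \<rho>)"
  shows "(k + l) * B + 2 * m \<le> A * s + k * \<rho> + l * (l - 1)"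
proof -
  define C where "C = A + B"
  define q where "q = B * N - C * s"
  define X where "X = A * s + k * \<rho> + l * (l - 1) - ((k + l) * B + 2 * m)"
  \<comment> \<open>\<open>k \<le> N - s - l\<close> may be replaced by equality, since its coefficient \<open>\<rho> - B\<close> is nonpositive. The
    resulting bound on the integer \<open>X\<close> is only \<open>X > - 1\<close>; it is shown for \<open>(A + B) X\<close> to avoid fractions.\<close>
  have "(N - s - l) * (\<rho> - B) \<le> k * (\<rho> - B)"
    using kl assms(5) by (intro mult_right_mono_neg) auto
  then have X_ge: "\<rho> * (N - s) - q - l * \<rho> + l * (l - 1) - 2 * m \<le> X"
    by (simp add: X_def q_def C_def algebra_simps)
  have "C * (C + 2 * m - 1) + q < C * (N - s)"
    using big by (simp add: q_def C_def algebra_simps)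
  then have "\<rho> * (C * (C + 2 * m - 1) + q) < \<rho> * (C * (N - s))"
    using assms(4) by (intro mult_strict_left_mono) auto
  moreover have "C * (\<rho> * (N - s) - q - l * \<rho> + l * (l - 1) - 2 * m) \<le> C * X"
    using X_ge assms(1,2) by (intro mult_left_mono) (auto simp: C_def)
  moreover have "0 \<le> (C - \<rho>) * (C * \<rho> - q)"
    using assms(1,5) \<rho> by (intro mult_nonneg_nonneg) (auto simp: C_def q_def algebra_simps)
  moreover have "C * (- 1) \<le> C * (\<rho> * \<rho> - \<rho> * l + l * l - \<rho> - l)"
    using quadratic_form_ge_minus_1[of \<rho> l] assms(1,2) by (intro mult_left_mono) (auto simp: C_def)
  moreover have "0 \<le> C * (2 * m * (\<rho> - 1))" using assms by (simp add: C_def)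
  ultimately have "C * (- 1) < C * X" by (simp add: algebra_simps)
  then have "- 1 < X" using assms(1,2) unfolding C_def by (simp only: mult_less_cancel_left)
  then show ?thesis by (simp add: X_def)
qed

lemma cut_inequality_high_threshold:
  fixes A B N m s k l \<rho> :: int
  assumes "2 \<le> A" "2 \<le> B" "B < \<rho>" "1 \<le> k" "A < k + l" "l \<le> B"
    and big: "(A + B + 2 * m - 1) * (A + B) < A * N"
    and \<rho>: "B * N \<le> (A + B) * (s + \<rho>)"
    and k: "k * (\<rho> - B + 1) \<le> 2 * m"
  shows "(k + l) * B + 2 * m \<le> A * s + k * \<rho> + l * (l - 1)"
proof -
  define C where "C = A + B"
  have "B * ((C + 2 * m - 1) * C) < B * (A * N)"
    using big assms(2) unfolding C_def by (intro mult_strict_left_mono) auto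
  also have "\<dots> \<le> A * (C * (s + \<rho>))"
    using \<rho> assms(1) unfolding C_def mult.left_commute[of B] by (intro mult_left_mono) auto
  finally have "C * (B * (C + 2 * m - 1)) < C * (A * (s + \<rho>))" by (simp add: algebra_simps)
  then have s_ge: "B * (C + 2 * m - 1) < A * (s + \<rho>)"
    using assms(1,2) by (simp add: C_def mult_less_cancel_left)
  have "(B - 1) * 1 \<le> (B - 1) * k" using assms(2,4) by (intro mult_left_mono) auto
  then have "A \<le> B * k" using assms(5,6) by (simp add: algebra_simps)
  then have "A * (\<rho> - B) \<le> B * k * (\<rho> - B)" using assms(3) by (intro mult_right_mono) auto
  moreover have "(B - 1) * (k * (\<rho> - B + 1)) \<le> (B - 1) * (2 * m)"
    using k assms(2) by (intro mult_left_mono) auto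
  moreover have "0 \<le> (B - 1) * k" using assms(2,4) by simp
  ultimately show ?thesis
    using s_ge quadratic_form_ge_minus_1[of B l] by (simp add: C_def algebra_simps)
qed

lemma sum_ge_if_clique_degrees:
  fixes d h :: "'a \<Rightarrow> int"
  assumes "finite T" "L \<subseteq> T" and h: "(\<Sum>x\<in>T. h x) \<le> 2 * m"
    and low: "\<And>x. x \<in> L \<Longrightarrow> int (card L) - 1 \<le> h x + d x"
    and high: "\<And>x. x \<in> T - L \<Longrightarrow> \<rho> \<le> h x + d x"
  shows "int (card (T - L)) * \<rho> + int (card L) * (int (card L) - 1) \<le> (\<Sum>x\<in>T. d x) + 2 * m"
proof -
  have "int (card (T - L)) * \<rho> \<le> (\<Sum>x\<in>T - L. h x + d x)"
    using high by (rule sum_bounded_below)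
  moreover have "int (card L) * (int (card L) - 1) \<le> (\<Sum>x\<in>L. h x + d x)"
    using low by (rule sum_bounded_below)
  moreover have "(\<Sum>x\<in>T. h x + d x) = (\<Sum>x\<in>T - L. h x + d x) + (\<Sum>x\<in>L. h x + d x)"
    using assms(1,2) by (intro sum.subset_diff)
  ultimately show ?thesis using h by (simp add: sum.distrib)
qed

lemma cut_inequality_threshold:
  fixes A B D N m s k l \<rho> :: int
  assumes params: "2 \<le> A" "2 \<le> B" "0 \<le> m" "A < k + l" "0 \<le> D"
    and N: "s + k + l \<le> N" "(A + B + 2 * m - 1) * (A + B) < A * N"
    and \<rho>: "B * N \<le> (A + B) * (s + \<rho>)"
    and D: "k * \<rho> + l * (l - 1) \<le> D + 2 * m"
    and above: "B < \<rho> \<Longrightarrow> 1 \<le> k \<and> l \<le> B \<and> k * (\<rho> - B + 1) \<le> 2 * m"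
  shows "(k + l) * B \<le> A * s + D"
proof -
  consider (nonpositive) "\<rho> \<le> 0" | (low) "1 \<le> \<rho>" "\<rho> \<le> B" | (high) "B < \<rho>" by linarith
  then show ?thesis
  proof cases
    case nonpositive
    have "(k + l) * B \<le> (N - s) * B" using N(1) params(2) by (intro mult_right_mono) auto
    moreover have "(A + B) * (s + \<rho>) \<le> (A + B) * s"
      using nonpositive params by (intro mult_left_mono) auto
    ultimately show ?thesis using \<rho> params(5) by (simp add: algebra_simps)
  next
    case low
    then have "(k + l) * B + 2 * m \<le> A * s + k * \<rho> + l * (l - 1)"
      using params N \<rho> by (intro cut_inequality_low_threshold)
    then show ?thesis using D by linarith
  next
    case high
    then have "(k + l) * B + 2 * m \<le> A * s + k * \<rho> + l * (l - 1)"
      using params N(2) \<rho> above by (intro cut_inequality_high_threshold) auto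
    then show ?thesis using D by linarith
  qed
qed

lemma cut_inequality_many_vertices:
  fixes d h :: "'a \<Rightarrow> int" and A B m s N :: int
  assumes fin: "finite T" and L: "L \<subseteq> T"
    and params: "2 \<le> A" "2 \<le> B" "0 \<le> m"
    and many: "A < int (card T)" "B < int (card T)"
    and N: "s + int (card T) \<le> N" "(A + B + 2 * m - 1) * (A + B) < A * N"
    and d: "\<And>x. x \<in> T \<Longrightarrow> 0 \<le> d x" "\<And>x. x \<in> T \<Longrightarrow> d x < B"
    and h: "\<And>x. x \<in> T \<Longrightarrow> 0 \<le> h x" "(\<Sum>x\<in>T. h x) \<le> 2 * m"
    and low: "\<And>x. x \<in> L \<Longrightarrow> int (card L) - 1 \<le> h x + d x"
    and high: "\<And>x. x \<in> T - L \<Longrightarrow> B * N \<le> (A + B) * (s + h x + d x)"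
    and small: "y \<in> T" "h y + d y < B"
  shows "int (card T) * B \<le> A * s + (\<Sum>x\<in>T. d x)"
proof -
  define k where "k = int (card (T - L))"
  define l where "l = int (card L)"
  have kl: "int (card T) = k + l"
    using fin L card_mono[OF fin L] by (simp add: k_def l_def card_Diff_subset finite_subset)
  have "T - L \<noteq> {}"
  proof
    assume "T - L = {}"
    then have "L = T" using L by blast
    then show False using low[of y] small many(2) by simp
  qed
  then obtain x where x: "x \<in> T - L" "\<And>y. y \<in> T - L \<Longrightarrow> h x + d x \<le> h y + d y"
    using ex_min_if_finite[of "(\<lambda>x. h x + d x) ` (T - L)"] fin by (auto simp: not_less)
  define \<rho> where "\<rho> = h x + d x"
  have \<rho>: "B * N \<le> (A + B) * (s + \<rho>)" using high[OF x(1)] by (simp add: \<rho>_def add.assoc)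
  have "(k + l) * B \<le> A * s + (\<Sum>x\<in>T. d x)"
  proof (rule cut_inequality_threshold[OF params(1-3) _ _ _ N(2) \<rho>])
    show "0 \<le> (\<Sum>x\<in>T. d x)" using d(1) by (rule sum_nonneg)
    show "k * \<rho> + l * (l - 1) \<le> (\<Sum>x\<in>T. d x) + 2 * m"
      unfolding k_def l_def using fin L h(2) low x(2) by (intro sum_ge_if_clique_degrees) (auto simp: \<rho>_def)
    show "1 \<le> k \<and> l \<le> B \<and> k * (\<rho> - B + 1) \<le> 2 * m" if "B < \<rho>"
    proof (intro conjI)
      show "1 \<le> k" using x(1) fin by (auto simp: k_def Suc_le_eq card_gt_0_iff)
      have "y \<in> L" using small x(2)[of y] that by (auto simp: \<rho>_def)
      then show "l \<le> B" using low[of y] small(2) by (simp add: l_def)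
      have "k * (\<rho> - B + 1) \<le> (\<Sum>x\<in>T - L. h x)"
        unfolding k_def using x(2) d(2) by (intro sum_bounded_below) (force simp: \<rho>_def)
      also have "\<dots> \<le> (\<Sum>x\<in>T. h x)" using fin h(1) by (intro sum_mono2) auto
      finally show "k * (\<rho> - B + 1) \<le> 2 * m" using h(2) by simp
    qed
  qed (use many(1) N(1) kl in auto)
  then show ?thesis using kl by simp
qed

lemma cut_inequality:
  fixes d h :: "'a \<Rightarrow> int" and A B b m s N :: int
  assumes fin: "finite T" and L: "L \<subseteq> T"
    and params: "2 \<le> A" "2 \<le> B" "A \<le> b" "B \<le> b" "0 \<le> m" "0 \<le> s"
    and N: "s + int (card T) \<le> N" "(A + B + 2 * m - 1) * (A + B) < A * N"
    and d: "\<And>x. x \<in> T \<Longrightarrow> 0 \<le> d x" "\<And>x. x \<in> T \<Longrightarrow> d x < B"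
    and h: "\<And>x. x \<in> T \<Longrightarrow> 0 \<le> h x" "\<And>x. x \<in> T \<Longrightarrow> h x \<le> m" "(\<Sum>x\<in>T. h x) \<le> 2 * m"
    and lower: "\<And>x. x \<in> T \<Longrightarrow> A * m + b * B \<le> A * (s + h x + d x)"
    and low: "\<And>x. x \<in> L \<Longrightarrow> int (card L) - 1 \<le> h x + d x"
    and high: "\<And>x. x \<in> T - L \<Longrightarrow> B * N \<le> (A + B) * (s + h x + d x)"
  shows "int (card T) * B \<le> A * s + (\<Sum>x\<in>T. d x)"
proof -
  consider (few) "int (card T) \<le> b"
    | (small_deficits) "b < int (card T)" "\<And>x. x \<in> T \<Longrightarrow> B \<le> h x + d x"
    | (many) y where "b < int (card T)" "y \<in> T" "h y + d y < B"
    by force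
  then show ?thesis
  proof cases
    case few
    have "b * B \<le> A * (s + d x)" if "x \<in> T" for x
    proof -
      have "A * h x \<le> A * m" using h(2)[OF that] params by (intro mult_left_mono) auto
      then show ?thesis using lower[OF that] by (simp add: algebra_simps)
    qed
    then show ?thesis
      using few params fin d by (intro cut_inequality_few_vertices) (auto intro: less_imp_le)
  next
    case small_deficits
    then show ?thesis using params h(3) lower
      by (intro cut_inequality_small_deficits[where h = h and b = b and m = m]) auto
  next
    case many
    then show ?thesis using params
      by (intro cut_inequality_many_vertices[OF fin L _ _ _ _ _ N d h(1,3) low high]) auto
  qed
qed

section \<open>Critical deleted graphs\<close>

lemma vertex_degree_le_deleted:
  assumes "simple_graph V E" "finite W" "finite H" "x \<notin> W"
  shows "vertex_degree E x
    \<le> card W + vertex_degree H x + vertex_degree (edges_minus E W - H) x"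
proof -
  have "finite (edges_minus E W)" using finite_edges[OF assms(1)] by (simp add: edges_minus_def)
  then show ?thesis
    using vertex_degree_le_edges_minus[OF assms(1,2,4)] vertex_degree_le_Diff[of "edges_minus E W" H x]
      assms(3) by simp
qed

lemma card_clique_le_deleted_degree:
  assumes "finite E" "finite H" "L \<inter> W = {}" "x \<in> L"
    and clique: "\<And>y. y \<in> L \<Longrightarrow> x \<noteq> y \<Longrightarrow> {x, y} \<in> E"
  shows "card L \<le> Suc (vertex_degree H x + vertex_degree (edges_minus E W - H) x)"
proof -
  have fin: "finite (edges_minus E W)" using assms(1) by (simp add: edges_minus_def)
  have "card (L - {x}) \<le> vertex_degree (edges_minus E W) x"
    using fin assms(3-5) by (intro card_le_vertex_degree) (auto simp: edges_minus_def)
  also have "\<dots> \<le> vertex_degree H x + vertex_degree (edges_minus E W - H) x"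
    using fin assms(2) by (rule vertex_degree_le_Diff)
  finally show ?thesis using card_Diff_singleton[OF assms(4)] by linarith
qed

lemma deleted_cut_inequality:
  fixes A B b :: int and k m :: nat
  assumes G: "simple_graph V E"
    and params: "2 \<le> A" "2 \<le> B" "A \<le> b" "B \<le> b"
    and big: "(A + B + 2 * int m - 1) * (A + B) < A * (int (card V) - int k)"
    and min_deg: "A * (int m + int k) + b * B \<le> A * int (min_degree V E)"
    and nonadjacent: "\<And>x y. x \<in> V \<Longrightarrow> y \<in> V \<Longrightarrow> x \<noteq> y \<Longrightarrow> {x, y} \<notin> E \<Longrightarrow>
      B * (int (card V) - int k) \<le> (A + B) * (int (vertex_degree E x) - int k) \<or>
      B * (int (card V) - int k) \<le> (A + B) * (int (vertex_degree E y) - int k)"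
    and W: "W \<subseteq> V" "k \<le> card W" and T: "T \<subseteq> V - W" and H: "H \<subseteq> E" "card H = m"
    and small: "\<And>x. x \<in> T \<Longrightarrow> int (vertex_degree (edges_minus E W - H) x) < B"
  shows "int (card T) * B
    \<le> A * (int (card W) - int k) + (\<Sum>x\<in>T. int (vertex_degree (edges_minus E W - H) x))"
proof -
  define d where "d x = int (vertex_degree (edges_minus E W - H) x)" for x
  define h where "h x = int (vertex_degree H x)" for x
  define L where "L = {x \<in> T. (A + B) * (int (vertex_degree E x) - int k) < B * (int (card V) - int k)}"
  define s where "s = int (card W) - int k"
  have finV: "finite V" using G by (simp add: simple_graph_def)
  have fin: "finite E" "finite W" "finite T" "finite H"
    using finite_edges[OF G] finV W(1) T H(1) by (auto intro: finite_subset)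
  have G_H: "simple_graph V H" using G H(1) by (auto simp: simple_graph_def)
  have deg: "C * (int (vertex_degree E x) - int k) \<le> C * (s + h x + d x)"
    if "x \<in> T" "0 \<le> C" for x C
    using vertex_degree_le_deleted[OF G fin(2,4), of x] T that
    by (intro mult_left_mono) (force simp: s_def h_def d_def)+
  have clique: "{x, y} \<in> E" if "x \<in> L" "y \<in> L" "x \<noteq> y" for x y
    using nonadjacent[of x y] that T by (force simp: L_def)
  have "int (card T) * B \<le> A * s + (\<Sum>x\<in>T. d x)"
  proof (rule cut_inequality[where L = L and h = h, OF fin(3) _ params _ _ _ big])
    have "card W + card T = card (W \<union> T)" using fin T by (intro card_Un_disjoint[symmetric]) auto
    also have "\<dots> \<le> card V" using W(1) T finV by (intro card_mono) auto
    finally show "s + int (card T) \<le> int (card V) - int k" by (simp add: s_def)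
    show "h x \<le> int m" for x using vertex_degree_le_card[OF fin(4), of x] H(2) by (simp add: h_def)
    show "(\<Sum>x\<in>T. h x) \<le> 2 * int m"
      using sum_vertex_degree_le[OF fin(3) G_H] H(2) by (simp add: h_def flip: of_nat_sum)
    show "A * int m + b * B \<le> A * (s + h x + d x)" if "x \<in> T" for x
    proof -
      have "A * int (min_degree V E) \<le> A * int (vertex_degree E x)"
        using min_degree_le_vertex_degree[OF G, of x] that T params by (intro mult_left_mono) auto
      then have "A * int m + b * B \<le> A * (int (vertex_degree E x) - int k)"
        using min_deg by (simp add: algebra_simps)
      also have "\<dots> \<le> A * (s + h x + d x)" using that params by (intro deg) auto
      finally show ?thesis .
    qed
    show "B * (int (card V) - int k) \<le> (A + B) * (s + h x + d x)" if "x \<in> T - L" for x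
      by (rule order_trans[OF _ deg]) (use that params in \<open>auto simp: L_def\<close>)
    show "int (card L) - 1 \<le> h x + d x" if "x \<in> L" for x
      using card_clique_le_deleted_degree[OF fin(1,4) _ that clique[OF that], of W] T
      by (force simp: h_def d_def L_def)
  qed (use W(2) small in \<open>auto simp: L_def s_def d_def h_def\<close>)
  then show ?thesis by (simp add: d_def s_def)
qed

theorem fractional_critical_deleted_if_nonadjacent_degree_condition:
  fixes A B b :: int and k m :: nat
  assumes G: "simple_graph V E"
    and params: "2 \<le> A" "2 \<le> B" "A \<le> b" "B \<le> b"
    and g: "\<And>x. x \<in> V \<Longrightarrow> g x \<le> B" and f: "\<And>x. x \<in> V \<Longrightarrow> A \<le> f x"
    and gf: "\<And>x. x \<in> V \<Longrightarrow> g x \<le> f x"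
    and big: "(A + B + 2 * int m - 1) * (A + B) < A * (int (card V) - int k)"
    and min_deg: "A * (int m + int k) + b * B \<le> A * int (min_degree V E)"
    and nonadjacent: "\<And>x y. x \<in> V \<Longrightarrow> y \<in> V \<Longrightarrow> x \<noteq> y \<Longrightarrow> {x, y} \<notin> E \<Longrightarrow>
      B * (int (card V) - int k) \<le> (A + B) * (int (vertex_degree E x) - int k) \<or>
      B * (int (card V) - int k) \<le> (A + B) * (int (vertex_degree E y) - int k)"
  shows "fractional_critical_deleted V E g f k m"
  unfolding fractional_critical_deleted_def fractional_deleted_def
proof (intro allI impI, elim conjE)
  fix U H
  assume U: "U \<subseteq> V" "card U = k" and H: "H \<subseteq> edges_minus E U" "card H = m"
  show "\<exists>h. fractional_factor (V - U) (edges_minus E U - H) g f h"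
  proof (rule fractional_factor_if_cut_condition[OF simple_graph_edges_minus[OF G]])
    show "g x \<le> f x" if "x \<in> V - U" for x using gf that by simp
  next
    fix S T
    assume S: "S \<subseteq> V - U" and T: "T \<subseteq> V - U" and ST: "S \<inter> T = {}"
      and small: "\<And>x. x \<in> T \<Longrightarrow>
        int (vertex_degree (edges_minus (edges_minus E U - H) S) x) < g x"
    define d where "d x = int (vertex_degree (edges_minus E (U \<union> S) - H) x)" for x
    have d_eq: "int (vertex_degree (edges_minus (edges_minus E U - H) S) x) = d x" for x
      by (simp add: d_def edges_minus_edges_minus_Diff)
    have card_US: "card (U \<union> S) = k + card S"
      using U S G by (subst card_Un_disjoint) (auto simp: simple_graph_def intro: finite_subset)
    have g_le: "g x \<le> B" if "x \<in> T" for x using g T that by auto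
    have "(\<Sum>x\<in>T. g x) \<le> int (card T) * B" using g_le by (rule sum_bounded_above)
    also have "\<dots> \<le> A * (int (card (U \<union> S)) - int k) + (\<Sum>x\<in>T. d x)"
      unfolding d_def
    proof (rule deleted_cut_inequality[OF G params big min_deg nonadjacent])
      show "int (vertex_degree (edges_minus E (U \<union> S) - H) x) < B" if "x \<in> T" for x
        using small[OF that] g_le[OF that] unfolding d_eq by (simp add: d_def)
    qed (use U S T ST H card_US in \<open>auto simp: edges_minus_def\<close>)
    also have "A * (int (card (U \<union> S)) - int k) = int (card S) * A" by (simp add: card_US)
    also have "\<dots> \<le> (\<Sum>x\<in>S. f x)" using f S by (intro sum_bounded_below) auto
    finally show "(\<Sum>x\<in>T. g x) \<le> (\<Sum>x\<in>S. f x)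
        + (\<Sum>x\<in>T. int (vertex_degree (edges_minus (edges_minus E U - H) S) x))"
      by (simp add: d_eq)
  qed
qed

theorem theorem2:
  fixes V :: "'a set" and E :: "'a set set" and n b a n' m \<Delta> :: nat
    and g f :: "'a \<Rightarrow> int"
  assumes "simple_graph V E"
    and "card V = n"
    and "int b - int \<Delta> \<ge> int a" and "a \<ge> 2"
    and "real (min_degree V E) \<ge>
           real m + real n' + real b * (real b - real \<Delta>) / (real \<Delta> + real a)"
    and "real n > (real b + real a + 2 * real m - 1) * (real a + real b) / (real \<Delta> + real a)
           + real n'"
    and "\<forall>x\<in>V. int b - int \<Delta> \<ge> f x - int \<Delta> \<and> f x - int \<Delta> \<ge> g x \<and> g x \<ge> int a"
    and "\<forall>x\<in>V. \<forall>y\<in>V. x \<noteq> y \<and> {x, y} \<notin> E \<longrightarrow>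
           real (max (vertex_degree E x) (vertex_degree E y)) \<ge>
             ((real b - real \<Delta>) * real n + (real \<Delta> + real a) * real n') / (real b + real a)"
  shows "fractional_critical_deleted V E g f n' m"
proof -
  define A where "A = int \<Delta> + int a"
  define B where "B = int b - int \<Delta>"
  have params: "2 \<le> A" "2 \<le> B" "A \<le> int b" "B \<le> int b"
    using assms(3,4) by (auto simp: A_def B_def)
  have AB: "real \<Delta> + real a = of_int A" "real b - real \<Delta> = of_int B"
    "real b + real a = of_int (A + B)" "real a + real b = of_int (A + B)"
    by (auto simp: A_def B_def)
  show ?thesis
  proof (rule fractional_critical_deleted_if_nonadjacent_degree_condition[OF assms(1) params])
    show "(A + B + 2 * int m - 1) * (A + B) < A * (int (card V) - int n')"
      by (rule of_int_less_iff[where 'a = real, THEN iffD1])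
        (use assms(2) assms(6)[unfolded AB] params in \<open>simp add: field_simps\<close>)
    show "A * (int m + int n') + int b * B \<le> A * int (min_degree V E)"
      by (rule of_int_le_iff[where 'a = real, THEN iffD1])
        (use assms(5)[unfolded AB] params in \<open>simp add: field_simps\<close>)
    show "B * (int (card V) - int n') \<le> (A + B) * (int (vertex_degree E x) - int n') \<or>
        B * (int (card V) - int n') \<le> (A + B) * (int (vertex_degree E y) - int n')"
      if "x \<in> V" "y \<in> V" "x \<noteq> y" "{x, y} \<notin> E" for x y
      unfolding of_int_le_iff[where 'a = real, symmetric]
      using assms(2) assms(8)[rule_format, of x y, unfolded AB] that params
      by (auto simp: max_def divide_le_eq algebra_simps split: if_splits)
  qed (use assms(7) in \<open>force simp: A_def B_def\<close>)+
qed

end
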